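(* Let $\alpha\in(0,1)$ and $\beta\in(0,1-\alpha)$. Let $\mathcal{P}_0$ and $\mathcal{P}_1$ be classes of null and alternative data-generating distributions, let $T_n=T_n(\mathcal{X}_n)$ be a real-valued test statistic, and suppose that under every $P\in\mathcal{P}_0$ and for every permutation $\pi\in\mathbf{\Pi}_n$, $\mathcal{X}_n^\pi$ has the same distribution as $\mathcal{X}_n$ (so that in particular $T_n$ and $T_n^\pi$ have the same distribution under the null hypothesis). Assume that for every $P\in\mathcal{P}_1$ $$\mathbb{E}_P[T_n]\;\ge\;\mathbb{E}_P\big[\mathbb{E}_\pi\{T_n^\pi\mid\mathcal{X}_n\}\big]+\sqrt{\frac{3\,\mathrm{Var}_P[\mathbb{E}_\pi\{T_n^\pi\mid\mathcal{X}_n\}]}{\beta}}+\sqrt{\frac{3\,\mathrm{Var}_P[T_n]}{\beta}}+\sqrt{\frac{3\,\mathbb{E}_P[\mathrm{Var}_\pi\{T_n^\pi\mid\mathcal{X}_n\}]}{\alpha\beta}} .$$ Then the permutation test $\mathbb{1}(T_n>c_{1-\alpha,n})$ satisfies $$\sup_{P\in\mathcal{P}_0}\mathbb{P}_P(T_n>c_{1-\alpha,n})\le\alpha\qquad\text{and}\qquad\sup_{P\in\mathcal{P}_1}\mathbb{P}_P(T_n\le c_{1-\alpha,n})\le\beta .$$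
   Context: $\mathbf{\Pi}_n$ is the set of all $n!$ permutations of $\{1,\dots,n\}$. The data are $\mathcal{X}_n=(X_1,\dots,X_n)$ and, for $\pi\in\mathbf{\Pi}_n$, $\mathcal{X}_n^\pi$ denotes the permuted data: $\mathcal{X}_n^\pi=(X_{\pi_1},\dots,X_{\pi_n})$ in general (e.g. for pooled samples in two-sample testing), while for independence testing, where $\mathcal{X}_n=((Y_1,Z_1),\dots,(Y_n,Z_n))$, it is $\mathcal{X}_n^\pi=((Y_1,Z_{\pi_1}),\dots,(Y_n,Z_{\pi_n}))$. Put $T_n^\pi:=T_n(\mathcal{X}_n^\pi)$. $\mathbb{E}_\pi[\cdot\mid\mathcal{X}_n]$, $\mathrm{Var}_\pi[\cdot\mid\mathcal{X}_n]$ are the mean and variance when $\pi$ is uniform on $\mathbf{\Pi}_n$ (independent of the data) with $\mathcal{X}_n$ held fixed; $\mathbb{P}_P,\mathbb{E}_P,\mathrm{Var}_P$ refer to the data drawn under $P$. The permutation critical value is $c_{1-\alpha,n}:=\inf\{t: \frac1{n!}\sum_{\pi\in\mathbf{\Pi}_n}\mathbb{1}(T_n^\pi\le t)\ge 1-\alpha\}$.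
   Formalization: For each P in P_1 the formal statement also assumes E_P[T_n] > E_P[E_π{T_n^π|X_n}] strictly (a constant T_n satisfies the printed inequality but has type II error 1), and makes explicit that the moments appearing in the inequality are finite. *)

theory Defs
  imports "HOL-Probability.Probability" "HOL-Combinatorics.Permutations"
begin

definition perms :: "nat \<Rightarrow> (nat \<Rightarrow> nat) set" where
  "perms n = {\<pi>. \<pi> permutes {1..n}}"

text \<open>
  A sample of size \<open>n\<close> is a point of \<open>PiM {1..n} (\<lambda>_. S)\<close>, i.e. a function that is
  \<open>undefined\<close> off \<open>{1..n}\<close>. No independence of the coordinates is assumed.

  There are two ways of permuting a sample: reordering all observations, and, for testing
  independence of paired observations, reordering only the second components.
\<close>

definition permute_sample :: "nat \<Rightarrow> (nat \<Rightarrow> nat) \<Rightarrow> (nat \<Rightarrow> 'a) \<Rightarrow> nat \<Rightarrow> 'a" where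
  "permute_sample n \<pi> x = (\<lambda>i\<in>{1..n}. x (\<pi> i))"

definition permute_pairs ::
  "nat \<Rightarrow> (nat \<Rightarrow> nat) \<Rightarrow> (nat \<Rightarrow> 'b \<times> 'c) \<Rightarrow> nat \<Rightarrow> 'b \<times> 'c" where
  "permute_pairs n \<pi> x = (\<lambda>i\<in>{1..n}. (fst (x i), snd (x (\<pi> i))))"

text \<open>
  In the following, \<open>act \<pi> x\<close> is the sample \<open>x\<close> permuted by \<open>\<pi>\<close>. The conditional mean and
  variance given the data are taken over a uniformly random permutation, with \<open>x\<close> held fixed.
\<close>

definition perm_mean ::
  "nat \<Rightarrow> ((nat \<Rightarrow> nat) \<Rightarrow> 'd \<Rightarrow> 'd) \<Rightarrow> ('d \<Rightarrow> real) \<Rightarrow> 'd \<Rightarrow> real" where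
  "perm_mean n act T x = measure_pmf.expectation (pmf_of_set (perms n)) (\<lambda>\<pi>. T (act \<pi> x))"

definition perm_var ::
  "nat \<Rightarrow> ((nat \<Rightarrow> nat) \<Rightarrow> 'd \<Rightarrow> 'd) \<Rightarrow> ('d \<Rightarrow> real) \<Rightarrow> 'd \<Rightarrow> real" where
  "perm_var n act T x = measure_pmf.variance (pmf_of_set (perms n)) (\<lambda>\<pi>. T (act \<pi> x))"

text \<open>For \<open>0 < \<alpha> < 1\<close> the set below is nonempty and bounded below.\<close>

definition perm_crit ::
  "nat \<Rightarrow> ((nat \<Rightarrow> nat) \<Rightarrow> 'd \<Rightarrow> 'd) \<Rightarrow> ('d \<Rightarrow> real) \<Rightarrow> real \<Rightarrow> 'd \<Rightarrow> real" where
  "perm_crit n act T \<alpha> x =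
     Inf {t. 1 / fact n * (\<Sum>\<pi>\<in>perms n. of_bool (T (act \<pi> x) \<le> t)) \<ge> 1 - \<alpha>}"

definition perm_invariant ::
  "nat \<Rightarrow> ((nat \<Rightarrow> nat) \<Rightarrow> 'd \<Rightarrow> 'd) \<Rightarrow> 'd measure \<Rightarrow> bool" where
  "perm_invariant n act P \<longleftrightarrow> (\<forall>\<pi>\<in>perms n. distr P P (act \<pi>) = P)"

text \<open>The finiteness that the means and variances in the mean-gap inequality presuppose.\<close>

definition finite_perm_moments ::
  "nat \<Rightarrow> ((nat \<Rightarrow> nat) \<Rightarrow> 'd \<Rightarrow> 'd) \<Rightarrow> ('d \<Rightarrow> real) \<Rightarrow> 'd measure \<Rightarrow> bool" where
  "finite_perm_moments n act T P \<longleftrightarrow>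
     integrable P (\<lambda>x. (T x)\<^sup>2) \<and>
     integrable P (\<lambda>x. (perm_mean n act T x)\<^sup>2) \<and>
     integrable P (perm_var n act T)"

definition mean_gap ::
  "nat \<Rightarrow> ((nat \<Rightarrow> nat) \<Rightarrow> 'd \<Rightarrow> 'd) \<Rightarrow> ('d \<Rightarrow> real) \<Rightarrow> real \<Rightarrow> real \<Rightarrow> 'd measure \<Rightarrow> bool" where
  "mean_gap n act T \<alpha> \<beta> P \<longleftrightarrow>
     prob_space.expectation P T \<ge>
       prob_space.expectation P (perm_mean n act T)
       + sqrt (3 * prob_space.variance P (perm_mean n act T) / \<beta>)
       + sqrt (3 * prob_space.variance P T / \<beta>)
       + sqrt (3 * prob_space.expectation P (perm_var n act T) / (\<alpha> * \<beta>))"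

text \<open>
  Strictness of the gap between the means follows from \<open>mean_gap\<close> as soon as one of its three
  variance terms is positive. If all three vanish and the two means agree, \<open>mean_gap\<close> holds, but
  \<open>T\<close> is almost surely equal to a constant, which is also the critical value, so the test
  almost surely does not reject and its type II error is 1. This case has to be excluded.
\<close>

definition strict_mean_gap ::
  "nat \<Rightarrow> ((nat \<Rightarrow> nat) \<Rightarrow> 'd \<Rightarrow> 'd) \<Rightarrow> ('d \<Rightarrow> real) \<Rightarrow> 'd measure \<Rightarrow> bool" where
  "strict_mean_gap n act T P \<longleftrightarrow>
     prob_space.expectation P T > prob_space.expectation P (perm_mean n act T)"

end

theory Submission
  imports Defs
begin

text \<open>
  The critical value satisfies \<open>c \<le> t\<close> exactly when at least a fraction \<open>1 - \<alpha>\<close> of the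
  \<open>T\<^sup>\<pi>\<close> is \<open>\<le> t\<close>. Under the null, \<open>c\<close> is invariant under permuting the data, so the rejection
  probability is the mean over \<open>\<pi>\<close> of the probability of \<open>T\<^sup>\<pi> > c\<close>, and at most a fraction \<open>\<alpha>\<close>
  of the \<open>T\<^sup>\<pi>\<close> exceeds \<open>c\<close>.

  Under the alternative, Chebyshev's inequality over the permutations gives \<open>c \<le> m + sqrt (v / \<alpha>)\<close>
  with \<open>m\<close>, \<open>v\<close> the permutation mean and variance. Chebyshev for \<open>T\<close> and \<open>m\<close> and Markov for \<open>v\<close>,
  each at level \<open>\<beta> / 3\<close>, then give \<open>T > c\<close> outside an event of probability \<open>\<beta>\<close>. The strict
  inequality comes from the strict form of Markov's inequality when some variance term is positive,
  and from the strict gap of the means when all of them vanish.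
\<close>

section \<open>A sharpened Markov inequality\<close>

text \<open>For positive expectation this is Markov's inequality. If the expectation is 0, then
  \<open>Z\<close> vanishes almost surely and the conjunct \<open>0 < Z x\<close> makes the event
  null. Off the event, \<open>Z x\<close> is 0 or strictly below the threshold.\<close>

lemma (in prob_space) strict_Markov:
  fixes Z :: "'a \<Rightarrow> real"
  assumes Z: "integrable M Z" "\<And>x. 0 \<le> Z x" and k: "0 < k"
  shows "prob {x \<in> space M. 0 < Z x \<and> expectation Z / k \<le> Z x} \<le> k"
proof (cases "expectation Z = 0")
  case True
  then have "AE x in M. Z x = 0"
    using integral_nonneg_eq_0_iff_AE[OF Z(1)] Z(2) by simp
  then have "AE x in M. x \<notin> {x \<in> space M. 0 < Z x \<and> expectation Z / k \<le> Z x}"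
    by eventually_elim auto
  then have "prob {x \<in> space M. 0 < Z x \<and> expectation Z / k \<le> Z x} = 0"
    using Z(1) by (intro prob_eq_0[THEN iffD2]) (auto simp: borel_measurable_integrable)
  then show ?thesis using k by simp
next
  case False
  then have pos: "0 < expectation Z / k"
    using k integral_nonneg_AE[of Z M] Z(2) by (simp add: less_le)
  have "prob {x \<in> space M. 0 < Z x \<and> expectation Z / k \<le> Z x}
      \<le> prob {x \<in> space M. expectation Z / k \<le> Z x}"
    using Z(1) by (intro finite_measure_mono) (auto simp: borel_measurable_integrable)
  also have "\<dots> \<le> expectation Z / (expectation Z / k)"
    using integral_Markov_inequality_measure[OF Z(1), of "{}" "expectation Z / k"] Z(2) pos by simp
  also have "\<dots> = k" using False k by simp
  finally show ?thesis .
qed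

section \<open>The uniform distribution on permutations\<close>

lemma finite_perms: "finite (perms n)"
  by (simp add: perms_def finite_permutations)

lemma card_perms: "card (perms n) = fact n"
  by (simp add: perms_def card_permutations)

lemma perms_nonempty: "perms n \<noteq> {}"
  using card_perms[of n] by (metis card.empty fact_nonzero)

text \<open>Left translation in the symmetric group, undone by translating with
  \<open>inv \<pi>\<close>; it serves to reindex sums over \<open>perms n\<close>.\<close>

lemma bij_betw_comp_perms:
  assumes "\<pi> \<in> perms n"
  shows "bij_betw ((\<circ>) \<pi>) (perms n) (perms n)"
proof (rule bij_betw_byWitness[where f' = "(\<circ>) (inv \<pi>)"])
  have p: "\<pi> permutes {1..n}" using assms by (simp add: perms_def)
  show "\<forall>\<sigma>\<in>perms n. inv \<pi> \<circ> (\<pi> \<circ> \<sigma>) = \<sigma>" "\<forall>\<sigma>\<in>perms n. \<pi> \<circ> (inv \<pi> \<circ> \<sigma>) = \<sigma>"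
    using permutes_inv_o[OF p] by (simp_all add: o_assoc)
  show "(\<circ>) \<pi> ` perms n \<subseteq> perms n" "(\<circ>) (inv \<pi>) ` perms n \<subseteq> perms n"
    using p permutes_inv[OF p] by (auto simp: perms_def intro: permutes_compose)
qed

lemma perm_mean_eq: "perm_mean n act T x = (\<Sum>\<pi>\<in>perms n. T (act \<pi> x)) / fact n"
  by (simp add: perm_mean_def integral_pmf_of_set perms_nonempty finite_perms card_perms)

lemma perm_var_eq:
  "perm_var n act T x = (\<Sum>\<pi>\<in>perms n. (T (act \<pi> x) - perm_mean n act T x)\<^sup>2) / fact n"
  by (simp add: perm_var_def perm_mean_def integral_pmf_of_set perms_nonempty finite_perms card_perms)

lemma perm_var_nonneg: "0 \<le> perm_var n act T x"
  by (simp add: perm_var_eq sum_nonneg)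

section \<open>The permutation distribution function and its quantile
  \<open>perm_crit\<close>\<close>

definition perm_cdf ::
  "nat \<Rightarrow> ((nat \<Rightarrow> nat) \<Rightarrow> 'd \<Rightarrow> 'd) \<Rightarrow> ('d \<Rightarrow> real) \<Rightarrow> 'd \<Rightarrow> real \<Rightarrow> real" where
  "perm_cdf n act T x t = 1 / fact n * (\<Sum>\<pi>\<in>perms n. of_bool (T (act \<pi> x) \<le> t))"

lemma perm_cdf_mono: "s \<le> t \<Longrightarrow> perm_cdf n act T x s \<le> perm_cdf n act T x t"
  unfolding perm_cdf_def by (intro mult_left_mono sum_mono) auto

lemma one_minus_perm_cdf:
  "1 - perm_cdf n act T x t = 1 / fact n * (\<Sum>\<pi>\<in>perms n. of_bool (t < T (act \<pi> x)))"
proof -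
  have "(\<Sum>\<pi>\<in>perms n. of_bool (T (act \<pi> x) \<le> t)) + (\<Sum>\<pi>\<in>perms n. of_bool (t < T (act \<pi> x)))
      = (\<Sum>\<pi>\<in>perms n. (1::real))"
    unfolding sum.distrib[symmetric] by (intro sum.cong) auto
  then show ?thesis by (simp add: perm_cdf_def card_perms field_simps)
qed

lemma perm_cdf_eq_prob:
  "1 - perm_cdf n act T x t = measure_pmf.prob (pmf_of_set (perms n)) {\<pi>. t < T (act \<pi> x)}"
  unfolding one_minus_perm_cdf
  by (simp add: measure_pmf_of_set perms_nonempty finite_perms card_perms of_bool_def
      sum.If_cases Int_def)

text \<open>The distribution function is a step function with finitely many jumps, each attained, so
  the infimum is a minimum; monotonicity does the rest.\<close>

lemma perm_crit_le_iff:
  assumes "0 < \<alpha>" "\<alpha> < 1"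
  shows "perm_crit n act T \<alpha> x \<le> t \<longleftrightarrow> 1 - \<alpha> \<le> perm_cdf n act T x t"
proof -
  let ?F = "perm_cdf n act T x"
  define A where "A = {t. 1 - \<alpha> \<le> ?F t}"
  define V where "V = (\<lambda>\<pi>. T (act \<pi> x)) ` perms n"
  have fin: "finite V" "V \<noteq> {}" by (auto simp: V_def finite_perms perms_nonempty)
  have "?F (Max V) = 1"
    using fin by (simp add: perm_cdf_def card_perms V_def)
  then have top: "Max V \<in> A" using assms by (simp add: A_def)
  \<comment> \<open>The cdf only jumps at values of \<open>V\<close>, so a threshold in \<open>A\<close> can be lowered to one in \<open>V\<close>.\<close>
  have drop: "\<exists>s\<in>A \<inter> V. s \<le> t" if "t \<in> A" for t
  proof -
    have ne: "{v \<in> V. v \<le> t} \<noteq> {}"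
    proof
      assume "{v \<in> V. v \<le> t} = {}"
      then have "\<And>\<pi>. \<pi> \<in> perms n \<Longrightarrow> \<not> T (act \<pi> x) \<le> t" by (auto simp: V_def)
      \<comment> \<open>Here \<alpha> < 1 enters: the value 0 lies below
        \<open>1 - \<alpha>\<close>.\<close>
      then have "?F t = 0" by (simp add: perm_cdf_def)
      then show False using that assms by (simp add: A_def)
    qed
    define s where "s = Max {v \<in> V. v \<le> t}"
    have s: "s \<in> V" "s \<le> t"
      using Max_in[of "{v \<in> V. v \<le> t}"] ne fin by (auto simp: s_def)
    have "T (act \<pi> x) \<le> s" if "\<pi> \<in> perms n" "T (act \<pi> x) \<le> t" for \<pi>
      unfolding s_def using that fin by (intro Max_ge) (auto simp: V_def)
    then have "?F t \<le> ?F s"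
      unfolding perm_cdf_def by (intro mult_left_mono sum_mono) auto
    then show ?thesis using that s by (auto simp: A_def)
  qed
  define c where "c = Min (A \<inter> V)"
  have c: "c \<in> A" "\<And>t. t \<in> A \<Longrightarrow> c \<le> t"
  proof -
    have ne: "A \<inter> V \<noteq> {}" using drop[OF top] by auto
    then show "c \<in> A" using Min_in[of "A \<inter> V"] fin by (simp add: c_def)
    show "c \<le> t" if "t \<in> A" for t
      using drop[OF that] fin by (auto simp: c_def intro: Min_le[THEN order_trans])
  qed
  have "perm_crit n act T \<alpha> x = Inf A"
    by (simp add: perm_crit_def A_def perm_cdf_def)
  also have "\<dots> = c" using c by (intro cInf_eq_minimum) auto
  finally have "perm_crit n act T \<alpha> x = c" .
  then show ?thesis
    using c perm_cdf_mono[of c t n act T x] by (auto simp: A_def)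
qed

text \<open>Chebyshev over the permutations, with the data fixed, bounds the fraction of values
  above the right-hand side by \<alpha>. Zero variance is included, the bound then being the mean
  itself.\<close>

lemma perm_crit_le_mean_var:
  assumes "0 < \<alpha>" "\<alpha> < 1"
  shows "perm_crit n act T \<alpha> x \<le> perm_mean n act T x + sqrt (perm_var n act T x / \<alpha>)"
proof -
  let ?p = "pmf_of_set (perms n)" and ?m = "perm_mean n act T x" and ?v = "perm_var n act T x"
  let ?Z = "\<lambda>\<pi>. (T (act \<pi> x) - ?m)\<^sup>2"
  have v: "measure_pmf.expectation ?p ?Z = ?v"
    by (simp add: perm_var_def perm_mean_def)
  \<comment> \<open>Exceeding the bound strictly forces a positive squared deviation, so this lies
    in the event of \<open>strict_Markov\<close>.\<close>
  have "measure_pmf.prob ?p {\<pi>. ?m + sqrt (?v / \<alpha>) < T (act \<pi> x)}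
      \<le> measure_pmf.prob ?p {\<pi>. 0 < ?Z \<pi> \<and> ?v / \<alpha> \<le> ?Z \<pi>}"
  proof (intro measure_pmf.finite_measure_mono subsetI CollectI, clarify)
    fix \<pi> assume *: "?m + sqrt (?v / \<alpha>) < T (act \<pi> x)"
    have "0 \<le> sqrt (?v / \<alpha>)" using assms perm_var_nonneg[of n act T x] by simp
    then have "0 < T (act \<pi> x) - ?m" "(sqrt (?v / \<alpha>))\<^sup>2 \<le> ?Z \<pi>"
      using * by (linarith, intro power_mono) linarith+
    then show "0 < ?Z \<pi> \<and> ?v / \<alpha> \<le> ?Z \<pi>"
      using assms perm_var_nonneg[of n act T x] by simp
  qed simp
  also have "\<dots> \<le> \<alpha>"
    using measure_pmf.strict_Markov[of ?p ?Z \<alpha>] assms v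
    by (simp add: integrable_measure_pmf_finite perms_nonempty finite_perms)
  finally show ?thesis
    unfolding perm_crit_le_iff[OF assms] using perm_cdf_eq_prob[of n act T x "?m + sqrt (?v / \<alpha>)"]
    by linarith
qed

section \<open>Permutation actions on the sample space\<close>

text \<open>What the two ways of permuting share. The order is that of a right action: reading
  position \<open>i\<close> of the twice permuted sample applies \<sigma> to the index first, then
  \<pi>.\<close>

locale permutation_action =
  fixes n :: nat and act :: "(nat \<Rightarrow> nat) \<Rightarrow> 'd \<Rightarrow> 'd" and M :: "'d measure"
  assumes act_measurable [measurable]: "\<pi> \<in> perms n \<Longrightarrow> act \<pi> \<in> measurable M M"
    and act_act: "\<lbrakk>\<pi> \<in> perms n; \<sigma> \<in> perms n; x \<in> space M\<rbrakk> \<Longrightarrow> act \<sigma> (act \<pi> x) = act (\<pi> \<circ> \<sigma>) x"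
begin

text \<open>Permuting the data first merely enumerates the same values of the statistic in another
  order.\<close>

lemma perm_cdf_act:
  assumes "\<pi> \<in> perms n" "x \<in> space M"
  shows "perm_cdf n act T (act \<pi> x) t = perm_cdf n act T x t"
proof -
  have "(\<Sum>\<sigma>\<in>perms n. of_bool (T (act \<sigma> (act \<pi> x)) \<le> t))
      = (\<Sum>\<sigma>\<in>perms n. of_bool (T (act (\<pi> \<circ> \<sigma>) x) \<le> t) :: real)"
    using assms by (intro sum.cong) (auto simp: act_act)
  also have "\<dots> = (\<Sum>\<sigma>\<in>perms n. of_bool (T (act \<sigma> x) \<le> t))"
    by (rule sum.reindex_bij_betw[OF bij_betw_comp_perms[OF assms(1)]])
  finally show ?thesis by (simp add: perm_cdf_def)
qed

lemma perm_crit_act: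
  assumes "\<pi> \<in> perms n" "x \<in> space M"
  shows "perm_crit n act T \<alpha> (act \<pi> x) = perm_crit n act T \<alpha> x"
  using perm_cdf_act[OF assms, of T] by (simp add: perm_crit_def perm_cdf_def)

lemma borel_measurable_perm_mean [measurable]:
  assumes [measurable]: "T \<in> borel_measurable M"
  shows "perm_mean n act T \<in> borel_measurable M"
  unfolding perm_mean_eq[abs_def] by measurable

lemma borel_measurable_perm_cdf [measurable]:
  assumes [measurable]: "T \<in> borel_measurable M"
  shows "(\<lambda>x. perm_cdf n act T x t) \<in> borel_measurable M"
  unfolding perm_cdf_def by measurable

text \<open>An infimum over a continuum of thresholds is handled through its sublevel sets, which
  \<open>perm_crit_le_iff\<close> expresses by a finite sum.\<close>

lemma borel_measurable_perm_crit [measurable]: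
  assumes [measurable]: "T \<in> borel_measurable M" and \<alpha>: "0 < \<alpha>" "\<alpha> < 1"
  shows "perm_crit n act T \<alpha> \<in> borel_measurable M"
  unfolding borel_measurable_iff_le perm_crit_le_iff[OF \<alpha>] by measurable

section \<open>The two error bounds\<close>

lemma type_I_error:
  assumes T: "T \<in> borel_measurable M" and \<alpha>: "0 < \<alpha>" "\<alpha> < 1"
    and P: "P \<in> space (prob_algebra M)" and inv: "perm_invariant n act P"
  shows "emeasure P {x \<in> space P. T x > perm_crit n act T \<alpha> x} \<le> ennreal \<alpha>"
proof -
  interpret prob_space P using P by (simp add: space_prob_algebra)
  have sets_P [measurable_cong]: "sets P = sets M" using P by (simp add: space_prob_algebra)
  have space_P: "space P = space M" by (rule sets_eq_imp_space_eq[OF sets_P])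
  note [measurable] = T borel_measurable_perm_crit[OF T \<alpha>]
  let ?c = "perm_crit n act T \<alpha>"
  let ?R = "{x \<in> space P. ?c x < T x}"
  let ?R' = "\<lambda>\<pi>. {x \<in> space P. ?c x < T (act \<pi> x)}"
  have R [measurable]: "?R \<in> sets P" by measurable
  have R' [measurable]: "?R' \<pi> \<in> sets P" if [measurable]: "\<pi> \<in> perms n" for \<pi> by measurable
  \<comment> \<open>Pulling \<open>?R\<close> back along \<open>act \<pi>\<close> changes only the
    statistic, since the critical value is invariant.\<close>
  have "prob ?R = prob (?R' \<pi>)" if \<pi>: "\<pi> \<in> perms n" for \<pi>
  proof -
    have [measurable]: "act \<pi> \<in> measurable P P"
      using act_measurable[OF \<pi>] by (simp add: measurable_cong_sets[OF sets_P sets_P])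
    have "prob ?R = measure (distr P P (act \<pi>)) ?R"
      using inv \<pi> by (simp add: perm_invariant_def)
    also have "\<dots> = prob (act \<pi> -` ?R \<inter> space P)" by (rule measure_distr) measurable
    also have "act \<pi> -` ?R \<inter> space P = ?R' \<pi>"
      using \<pi> perm_crit_act[OF \<pi>] measurable_space[OF act_measurable[OF \<pi>]] by (auto simp: space_P)
    finally show ?thesis .
  qed
  then have "(\<Sum>\<pi>\<in>perms n. prob ?R) = (\<Sum>\<pi>\<in>perms n. prob (?R' \<pi>))"
    by (intro sum.cong refl)
  then have "prob ?R = 1 / fact n * (\<Sum>\<pi>\<in>perms n. prob (?R' \<pi>))"
    by (simp add: card_perms field_simps)
  also have "(\<Sum>\<pi>\<in>perms n. prob (?R' \<pi>)) = (\<Sum>\<pi>\<in>perms n. expectation (indicator (?R' \<pi>)))"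
    by simp
  also have "\<dots> = expectation (\<lambda>x. \<Sum>\<pi>\<in>perms n. indicator (?R' \<pi>) x)"
    by (rule Bochner_Integration.integral_sum[symmetric])
      (simp add: emeasure_eq_measure R')
  also have "1 / fact n * \<dots> = expectation (\<lambda>x. 1 / fact n * (\<Sum>\<pi>\<in>perms n. indicator (?R' \<pi>) x))"
    by simp
  also have "\<dots> \<le> expectation (\<lambda>x. \<alpha>)"
  proof (rule integral_mono)
    fix x assume x: "x \<in> space P"
    \<comment> \<open>Pointwise, the averaged indicators give the fraction of values above
      \<open>?c x\<close>; \<open>perm_crit_le_iff\<close> at \<open>t = ?c x\<close> bounds
      it.\<close>
    have "1 / fact n * (\<Sum>\<pi>\<in>perms n. indicator (?R' \<pi>) x) = 1 - perm_cdf n act T x (?c x)"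
      unfolding one_minus_perm_cdf using x by (simp add: indicator_def)
    also have "\<dots> \<le> \<alpha>" using perm_crit_le_iff[OF \<alpha>, of n act T x "?c x"] by simp
    finally show "1 / fact n * (\<Sum>\<pi>\<in>perms n. indicator (?R' \<pi>) x) \<le> \<alpha>" .
  qed (auto intro!: integrable_mult_right Bochner_Integration.integrable_sum
      simp: emeasure_eq_measure R')
  also have "\<dots> = \<alpha>" by (simp add: prob_space)
  finally show ?thesis using \<alpha> by (simp add: emeasure_eq_measure ennreal_leI)
qed

lemma type_II_error:
  assumes T: "T \<in> borel_measurable M" and \<alpha>: "0 < \<alpha>" "\<alpha> < 1" and \<beta>: "0 < \<beta>"
    and P: "P \<in> space (prob_algebra M)" and moments: "finite_perm_moments n act T P"
    and gap: "mean_gap n act T \<alpha> \<beta> P" and strict: "strict_mean_gap n act T P"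
  shows "emeasure P {x \<in> space P. T x \<le> perm_crit n act T \<alpha> x} \<le> ennreal \<beta>"
proof -
  interpret prob_space P using P by (simp add: space_prob_algebra)
  have sets_P [measurable_cong]: "sets P = sets M" using P by (simp add: space_prob_algebra)
  let ?c = "perm_crit n act T \<alpha>"
  let ?m = "perm_mean n act T" and ?v = "perm_var n act T"
  have [measurable]: "T \<in> borel_measurable P" "?m \<in> borel_measurable P" "?c \<in> borel_measurable P"
    using T \<alpha> by measurable
  have [simp]: "integrable P (\<lambda>x. (T x)\<^sup>2)" "integrable P (\<lambda>x. (?m x)\<^sup>2)" "integrable P ?v"
    using moments by (simp_all add: finite_perm_moments_def)
  \<comment> \<open>On a probability space square integrability suffices, so the means are genuine
    and not the default value 0 of the integral.\<close>
  have [simp]: "integrable P T" "integrable P ?m"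
    by (rule square_integrable_imp_integrable; simp)+
  define Z1 where "Z1 = (\<lambda>x. (T x - expectation T)\<^sup>2)"
  define Z2 where "Z2 = (\<lambda>x. (?m x - expectation ?m)\<^sup>2)"
  have int: "integrable P Z1" "integrable P Z2"
    by (simp_all add: Z1_def Z2_def power2_diff)
  have nonneg: "0 \<le> Z1 x" "0 \<le> Z2 x" "0 \<le> ?v x" for x
    by (simp_all add: Z1_def Z2_def perm_var_nonneg)
  have [measurable]: "Z1 \<in> borel_measurable P" "Z2 \<in> borel_measurable P" "?v \<in> borel_measurable P"
    using int by (auto intro: borel_measurable_integrable)
  define B where "B Z = {x \<in> space P. 0 < Z x \<and> expectation Z / (\<beta> / 3) \<le> Z x}" for Z
  have B: "prob (B Z1) \<le> \<beta> / 3" "prob (B Z2) \<le> \<beta> / 3" "prob (B ?v) \<le> \<beta> / 3"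
    unfolding B_def by (rule strict_Markov; simp add: int nonneg \<beta>)+
  have [measurable]: "B Z1 \<in> sets P" "B Z2 \<in> sets P" "B ?v \<in> sets P"
    unfolding B_def by measurable
  \<comment> \<open>\<open>a\<close>, \<open>b\<close>, \<open>d\<close> are the square roots in
    \<open>mean_gap\<close> for \<open>T\<close>, \<open>?m\<close>, \<open>?v\<close>, with the
    factor 3 written as the level \<open>\<beta> / 3\<close>.\<close>
  define a where "a = sqrt (expectation Z1 / (\<beta> / 3))"
  define b where "b = sqrt (expectation Z2 / (\<beta> / 3))"
  define d where "d = sqrt (expectation ?v / (\<beta> / 3) / \<alpha>)"
  have E: "0 \<le> expectation Z1" "0 \<le> expectation Z2" "0 \<le> expectation ?v"
    using nonneg by (auto intro: integral_nonneg_AE)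
  then have abd: "0 \<le> a" "0 \<le> b" "0 \<le> d" using \<alpha> \<beta> by (simp_all add: a_def b_def d_def)
  have gap': "expectation ?m + a + b + d \<le> expectation T"
    using gap by (simp add: mean_gap_def a_def b_def d_def Z1_def Z2_def mult.commute algebra_simps)
  have strict': "expectation ?m < expectation T"
    using strict by (simp add: strict_mean_gap_def)
  have T_gt: "?c x < T x" if x: "x \<in> space P" "x \<notin> B Z1" "x \<notin> B Z2" "x \<notin> B ?v" for x
  proof -
    have 1: "\<bar>T x - expectation T\<bar> < a \<or> T x = expectation T"
      unfolding a_def using x
      by (auto simp: B_def Z1_def real_sqrt_abs[symmetric] simp del: real_sqrt_abs)
    have 2: "\<bar>?m x - expectation ?m\<bar> < b \<or> ?m x = expectation ?m"
      unfolding b_def using x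
      by (auto simp: B_def Z2_def real_sqrt_abs[symmetric] simp del: real_sqrt_abs)
    \<comment> \<open>Nonnegativity turns the failure of \<open>0 < ?v x\<close> into
      equality.\<close>
    have "?v x < expectation ?v / (\<beta> / 3) \<or> ?v x = 0"
      using x nonneg(3)[of x] by (auto simp: B_def)
    then have 3: "sqrt (?v x / \<alpha>) < d \<or> sqrt (?v x / \<alpha>) = 0"
      unfolding d_def real_sqrt_less_iff using divide_strict_right_mono \<alpha>(1) by fastforce
    have "?c x \<le> ?m x + sqrt (?v x / \<alpha>)" by (rule perm_crit_le_mean_var[OF \<alpha>])
    \<comment> \<open>If a first alternative holds in \<open>1\<close>, \<open>2\<close> or
      \<open>3\<close>, its strictness carries over through \<open>gap'\<close>. Otherwise all three
      deviations are 0 and \<open>strict'\<close> decides.\<close>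
    also have "\<dots> < T x" using 1 2 3 abd gap' strict' by linarith
    finally show ?thesis .
  qed
  have "prob {x \<in> space P. T x \<le> ?c x} \<le> prob (B Z1 \<union> B Z2 \<union> B ?v)"
    using T_gt by (intro finite_measure_mono) (auto simp: not_less[symmetric])
  also have "\<dots> \<le> prob (B Z1 \<union> B Z2) + prob (B ?v)"
    by (rule measure_Un_le) measurable
  also have "\<dots> \<le> prob (B Z1) + prob (B Z2) + prob (B ?v)"
    by (intro add_right_mono measure_Un_le) measurable
  also have "\<dots> \<le> \<beta>" using B by linarith
  finally show ?thesis using \<beta> by (simp add: emeasure_eq_measure ennreal_leI)
qed

lemma permutation_test:
  assumes "0 < \<alpha>" "\<alpha> < 1" "0 < \<beta>"
  shows "T \<in> borel_measurable M \<and>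
      P0 \<subseteq> space (prob_algebra M) \<and> P1 \<subseteq> space (prob_algebra M) \<and>
      (\<forall>P\<in>P0. perm_invariant n act P) \<and>
      (\<forall>P\<in>P1. finite_perm_moments n act T P \<and> mean_gap n act T \<alpha> \<beta> P \<and> strict_mean_gap n act T P)
      \<longrightarrow>
      (SUP P\<in>P0. emeasure P {x \<in> space P. T x > perm_crit n act T \<alpha> x}) \<le> ennreal \<alpha> \<and>
      (SUP P\<in>P1. emeasure P {x \<in> space P. T x \<le> perm_crit n act T \<alpha> x}) \<le> ennreal \<beta>"
  using assms by (auto intro!: SUP_least type_I_error type_II_error)

end

section \<open>Reordering samples and re-pairing as permutation actions\<close>

lemma perms_in_range: "\<pi> \<in> perms n \<Longrightarrow> i \<in> {1..n} \<Longrightarrow> \<pi> i \<in> {1..n}"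
  unfolding perms_def by (simp only: mem_Collect_eq permutes_in_image)

lemma permutation_action_permute_sample:
  "permutation_action n (permute_sample n) (PiM {1..n} (\<lambda>_. S))"
proof
  fix \<pi> assume \<pi>: "\<pi> \<in> perms n"
  show "permute_sample n \<pi> \<in> measurable (PiM {1..n} (\<lambda>_. S)) (PiM {1..n} (\<lambda>_. S))"
    unfolding permute_sample_def
    using perms_in_range[OF \<pi>] by (intro measurable_restrict measurable_component_singleton)
next
  fix \<pi> \<sigma> x assume "\<sigma> \<in> perms n"
  then show "permute_sample n \<sigma> (permute_sample n \<pi> x) = permute_sample n (\<pi> \<circ> \<sigma>) x"
    \<comment> \<open>The inner restriction is evaluated at \<open>\<sigma> i\<close>, which stays
      in the index set; off that set both sides are \<open>undefined\<close>.\<close>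
    using perms_in_range[of \<sigma> n] by (auto simp: permute_sample_def restrict_def fun_eq_iff)
qed

text \<open>First components stay in place under both permutations, while the second components
  compose as in a plain reordering.\<close>

lemma permutation_action_permute_pairs:
  "permutation_action n (permute_pairs n) (PiM {1..n} (\<lambda>_. SY \<Otimes>\<^sub>M SZ))"
proof
  fix \<pi> assume \<pi>: "\<pi> \<in> perms n"
  have [measurable]: "(\<lambda>x. x i) \<in> measurable (PiM {1..n} (\<lambda>_. SY \<Otimes>\<^sub>M SZ)) (SY \<Otimes>\<^sub>M SZ)"
    if "i \<in> {1..n}" for i
    using that by (rule measurable_component_singleton)
  show "permute_pairs n \<pi> \<in>
      measurable (PiM {1..n} (\<lambda>_. SY \<Otimes>\<^sub>M SZ)) (PiM {1..n} (\<lambda>_. SY \<Otimes>\<^sub>M SZ))"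
    unfolding permute_pairs_def
  proof (rule measurable_restrict)
    fix i assume i [measurable]: "i \<in> {1..n}"
    have [measurable]: "\<pi> i \<in> {1..n}" by (rule perms_in_range[OF \<pi> i])
    show "(\<lambda>x. (fst (x i), snd (x (\<pi> i)))) \<in>
        measurable (PiM {1..n} (\<lambda>_. SY \<Otimes>\<^sub>M SZ)) (SY \<Otimes>\<^sub>M SZ)"
      by measurable
  qed
next
  fix \<pi> \<sigma> x assume "\<sigma> \<in> perms n"
  then show "permute_pairs n \<sigma> (permute_pairs n \<pi> x) = permute_pairs n (\<pi> \<circ> \<sigma>) x"
    using perms_in_range[of \<sigma> n] by (auto simp: permute_pairs_def restrict_def fun_eq_iff)
qed

theorem lemma3p1:
  fixes \<alpha> \<beta> :: real and n :: nat
    and S :: "'a measure" and T :: "(nat \<Rightarrow> 'a) \<Rightarrow> real" and P0 P1 :: "(nat \<Rightarrow> 'a) measure set"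
    and SY :: "'b measure" and SZ :: "'c measure"
    and U :: "(nat \<Rightarrow> 'b \<times> 'c) \<Rightarrow> real" and Q0 Q1 :: "(nat \<Rightarrow> 'b \<times> 'c) measure set"
  assumes "0 < \<alpha>" "\<alpha> < 1" and "0 < \<beta>" "\<beta> < 1 - \<alpha>"
  shows
    "(T \<in> borel_measurable (PiM {1..n} (\<lambda>_. S)) \<and>
      P0 \<subseteq> space (prob_algebra (PiM {1..n} (\<lambda>_. S))) \<and>
      P1 \<subseteq> space (prob_algebra (PiM {1..n} (\<lambda>_. S))) \<and>
      (\<forall>P\<in>P0. perm_invariant n (permute_sample n) P) \<and>
      (\<forall>P\<in>P1. finite_perm_moments n (permute_sample n) T P \<and>
               mean_gap n (permute_sample n) T \<alpha> \<beta> P \<and>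
               strict_mean_gap n (permute_sample n) T P)
      \<longrightarrow>
      (SUP P\<in>P0. emeasure P {x \<in> space P. T x > perm_crit n (permute_sample n) T \<alpha> x}) \<le> ennreal \<alpha> \<and>
      (SUP P\<in>P1. emeasure P {x \<in> space P. T x \<le> perm_crit n (permute_sample n) T \<alpha> x}) \<le> ennreal \<beta>)
     \<and>
     (U \<in> borel_measurable (PiM {1..n} (\<lambda>_. SY \<Otimes>\<^sub>M SZ)) \<and>
      Q0 \<subseteq> space (prob_algebra (PiM {1..n} (\<lambda>_. SY \<Otimes>\<^sub>M SZ))) \<and>
      Q1 \<subseteq> space (prob_algebra (PiM {1..n} (\<lambda>_. SY \<Otimes>\<^sub>M SZ))) \<and>
      (\<forall>P\<in>Q0. perm_invariant n (permute_pairs n) P) \<and>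
      (\<forall>P\<in>Q1. finite_perm_moments n (permute_pairs n) U P \<and>
               mean_gap n (permute_pairs n) U \<alpha> \<beta> P \<and>
               strict_mean_gap n (permute_pairs n) U P)
      \<longrightarrow>
      (SUP P\<in>Q0. emeasure P {x \<in> space P. U x > perm_crit n (permute_pairs n) U \<alpha> x}) \<le> ennreal \<alpha> \<and>
      (SUP P\<in>Q1. emeasure P {x \<in> space P. U x \<le> perm_crit n (permute_pairs n) U \<alpha> x}) \<le> ennreal \<beta>)"
  using permutation_action.permutation_test[OF permutation_action_permute_sample assms(1-3)]
    permutation_action.permutation_test[OF permutation_action_permute_pairs assms(1-3)]
  by (intro conjI)

end
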